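(* Let $q$ be a prime power, $n=tt'$ with $t,t'\in\mathbb{N}$, and $s\in\mathbb{N}$ with $\gcd(s,t)=1$. The polynomials of the form $f(x)=\sum_{i=0}^{t'-1}a_ix^{q^{it+s}}$ with $a_i\in\mathbb{F}_{q^n}$ that are R-$q^t$-partially scattered are exactly those of the shape \[f(x)=\sum_{i=0}^{t'-1}\left(\alpha_0+\alpha^{q^{it}}\alpha_1+\dots+\alpha^{(t'-1)q^{it}}\alpha_{t'-1}\right)x^{q^{it+s}},\] where $\alpha$ is any primitive element of $\mathbb{F}_{q^n}$ and $\{\alpha_0,\dots,\alpha_{t'-1}\}$ is any $\mathbb{F}_{q^t}$-basis of $\mathbb{F}_{q^n}$. In particular, the number of R-$q^t$-partially scattered polynomials of this form is \[(q^n-1)(q^n-q^t)\cdots(q^n-q^{n-t}).\]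
   Context: An $\mathbb{F}_q$-linearized polynomial $f(x)\in\mathbb{F}_{q^n}[x]$ is R-$q^t$-partially scattered if for all $y,z\in\mathbb{F}_{q^n}^*$, $f(y)/y=f(z)/z$ and $y/z\in\mathbb{F}_{q^t}$ imply $y/z\in\mathbb{F}_q$.
   Formalization: The case t = 1 is excluded (t ≥ 2 is assumed): for t = 1 the claim is false, since every polynomial of the form, including f = 0, is vacuously R-q^t-partially scattered, while 0 is never of the displayed shape. *)

theory Defs
  imports
    "HOL-Computational_Algebra.Polynomial"
    "HOL-Number_Theory.Prime_Powers"
begin

definition is_subfield :: "'a::field set \<Rightarrow> bool" where
  "is_subfield K \<longleftrightarrow> 0 \<in> K \<and> 1 \<in> K \<and>
     (\<forall>x\<in>K. \<forall>y\<in>K. x + y \<in> K \<and> x * y \<in> K) \<and>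
     (\<forall>x\<in>K. - x \<in> K \<and> inverse x \<in> K)"

text \<open>Primitive in the finite-field sense: a generator of the multiplicative group.
  In a finite field the exponents may be taken to be natural numbers.\<close>

definition primitive_element :: "'a::{field,finite} \<Rightarrow> bool" where
  "primitive_element \<alpha> \<longleftrightarrow> range (\<lambda>k::nat. \<alpha> ^ k) = UNIV - {0}"

text \<open>Linear algebra over a subfield \<open>K\<close>, for families \<open>b 0, \<dots>, b (m - 1)\<close>; values of \<open>b\<close>
  at other indices are irrelevant.\<close>

definition lin_indep_over :: "'a::field set \<Rightarrow> nat \<Rightarrow> (nat \<Rightarrow> 'a) \<Rightarrow> bool" where
  "lin_indep_over K m b \<longleftrightarrow>
     (\<forall>c. (\<forall>j<m. c j \<in> K) \<longrightarrow> (\<Sum>j<m. c j * b j) = 0 \<longrightarrow> (\<forall>j<m. c j = 0))"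

definition spans_over :: "'a::field set \<Rightarrow> nat \<Rightarrow> (nat \<Rightarrow> 'a) \<Rightarrow> bool" where
  "spans_over K m b \<longleftrightarrow> (\<forall>x. \<exists>c. (\<forall>j<m. c j \<in> K) \<and> x = (\<Sum>j<m. c j * b j))"

definition is_basis_over :: "'a::field set \<Rightarrow> nat \<Rightarrow> (nat \<Rightarrow> 'a) \<Rightarrow> bool" where
  "is_basis_over K m b \<longleftrightarrow> lin_indep_over K m b \<and> spans_over K m b"

text \<open>\<open>K\<close>-linearized polynomials, for a finite subfield \<open>K\<close> of order \<open>q\<close>: only the monomials
  \<open>x, x\<^sup>q, x^(q^2), \<dots>\<close> occur.\<close>

definition linearized :: "'a::field set \<Rightarrow> 'a poly \<Rightarrow> bool" where
  "linearized K f \<longleftrightarrow> (\<forall>k. coeff f k \<noteq> 0 \<longrightarrow> (\<exists>i. k = card K ^ i))"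

text \<open>With \<open>K\<close> of order \<open>q\<close> and \<open>L\<close> of order \<open>q^t\<close>, this is the notion of an
  R-\<open>q^t\<close>-partially scattered polynomial.\<close>

definition R_partially_scattered :: "'a::field set \<Rightarrow> 'a set \<Rightarrow> 'a poly \<Rightarrow> bool" where
  "R_partially_scattered K L f \<longleftrightarrow> linearized K f \<and>
     (\<forall>y z. y \<noteq> 0 \<longrightarrow> z \<noteq> 0 \<longrightarrow> poly f y / y = poly f z / z \<longrightarrow> y / z \<in> L \<longrightarrow> y / z \<in> K)"

definition gap_poly :: "nat \<Rightarrow> nat \<Rightarrow> nat \<Rightarrow> nat \<Rightarrow> (nat \<Rightarrow> 'a::field) \<Rightarrow> 'a poly" where
  "gap_poly q t t' s a = (\<Sum>i<t'. monom (a i) (q ^ (i * t + s)))"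

definition basis_poly ::
    "nat \<Rightarrow> nat \<Rightarrow> nat \<Rightarrow> nat \<Rightarrow> 'a::field \<Rightarrow> (nat \<Rightarrow> 'a) \<Rightarrow> 'a poly" where
  "basis_poly q t t' s \<alpha> b =
     gap_poly q t t' s (\<lambda>i. \<Sum>j<t'. \<alpha> ^ (j * q ^ (i * t)) * b j)"

end

(*
  A polynomial f with exponents q^(it+s) satisfies f(cy) = c^(q^s) f(y) for c in F_(q^t).
  Since gcd(s,t) = 1, the only such c with c^(q^s) = c lie in F_q, so that f is
  R-q^t-partially scattered iff it has no nonzero root.  By invertibility of the Vandermonde
  matrix of the conjugates of \<alpha>, the coefficients of f can be written uniquely as
  a_i = sum_j b_j \<alpha>^(j q^(it)), and then f(y) = sum_j b_j Tr(\<alpha>^j y^(q^s)) with the trace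
  from F_(q^n) to F_(q^t).  As the powers \<alpha>^j with j < t' form a basis and the trace is not
  identically zero, independence of the b_j forces a trivial kernel; conversely an injective f is
  surjective, so the b_j span.  The polynomials are therefore counted by the ordered bases.
*)

theory Submission
  imports Defs "HOL-Number_Theory.Residues" "HOL-Algebra.Algebraic_Closure_Type"
begin

section \<open>Finite fields: a generator, subfields as fixed points, the characteristic\<close>

lemma ex_primitive_element: "\<exists>\<alpha> :: 'a::{field,finite}. primitive_element \<alpha>"
proof -
  \<comment> \<open>Viewing the type as a ring record gives access to the cyclicity of the
    multiplicative group of a finite field.\<close>
  define R where "R = (ring_of_type_algebra :: 'a ring)"
  interpret R: field R
    unfolding R_def by (rule field_from_type_algebra)
  have carrier: "carrier (mult_of R) = UNIV - {0}"
    by (simp add: R_def ring_of_type_algebra_def)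
  have pow: "a [^]\<^bsub>R\<^esub> (k::nat) = a ^ k" for a k
    by (induction k) (simp_all add: R_def ring_of_type_algebra_def mult.commute)
  obtain a where "carrier (mult_of R) = {a [^]\<^bsub>R\<^esub> i | i::nat. i \<in> UNIV}"
    using R.finite_field_mult_group_has_gen by (auto simp: nat_pow_mult_of)
  then have "range (\<lambda>k::nat. a ^ k) = UNIV - {0}"
    unfolding carrier pow by blast
  then show ?thesis
    unfolding primitive_element_def by blast
qed

text \<open>Multiplication by a nonzero \<open>x\<close> permutes \<open>K - {0}\<close>; comparing
  the product of all elements before and after yields Fermat's identity.\<close>

lemma subfield_power_card:
  fixes K :: "'a::{field,finite} set"
  assumes K: "is_subfield K" and x: "x \<in> K"
  shows "x ^ card K = x"
proof (cases "x = 0")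
  case True
  then show ?thesis
    using x by (auto simp: card_gt_0_iff zero_power)
next
  case False
  have "(\<Prod>y\<in>K - {0}. y) = (\<Prod>y\<in>K - {0}. x * y)"
    by (rule prod.reindex_bij_witness[of _ "\<lambda>y. x * y" "\<lambda>y. inverse x * y"])
      (use K x False in \<open>auto simp: is_subfield_def\<close>)
  also have "\<dots> = x ^ card (K - {0}) * (\<Prod>y\<in>K - {0}. y)"
    by (simp add: prod.distrib)
  finally have "x ^ card (K - {0}) = 1"
    by simp
  moreover have "card K = Suc (card (K - {0}))"
    by (rule card_Suc_Diff1[symmetric]) (use K in \<open>auto simp: is_subfield_def\<close>)
  ultimately show ?thesis
    by simp
qed

lemma card_power_eq_self_le:
  fixes k :: nat
  assumes "k \<ge> 2"
  shows "card {x::'a::{field,finite}. x ^ k = x} \<le> k"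
proof -
  define p where "p = (Polynomial.monom 1 k - Polynomial.monom 1 1 :: 'a poly)"
  \<comment> \<open>\<open>k \<ge> 2\<close> rules out \<open>k = 1\<close>, where the two monomials
    would cancel.\<close>
  have "Polynomial.coeff p k = 1"
    using assms by (simp add: p_def)
  then have "p \<noteq> 0"
    by auto
  moreover have "{x. x ^ k = x} = {x. poly p x = 0}"
    by (simp add: p_def poly_monom)
  moreover have "Polynomial.degree p \<le> k"
    unfolding p_def by (rule degree_diff_le) (use assms in \<open>auto simp: degree_monom_eq\<close>)
  ultimately show ?thesis
    using card_poly_roots_bound[of p] by simp
qed

text \<open>\<open>K\<close> lies inside the solution set of the equation, which has at most
  \<open>card K\<close> members, so the two coincide. Membership in a subfield thereby becomes a
  power equation.\<close>

lemma subfield_iff_power_card: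
  fixes K :: "'a::{field,finite} set"
  assumes "is_subfield K"
  shows "x \<in> K \<longleftrightarrow> x ^ card K = x"
proof -
  have "card {0, 1::'a} \<le> card K"
    by (intro card_mono) (use assms in \<open>auto simp: is_subfield_def\<close>)
  then have "card {x::'a. x ^ card K = x} \<le> card K"
    by (intro card_power_eq_self_le) simp
  then have "K = {x. x ^ card K = x}"
    by (intro card_seteq) (use subfield_power_card[OF assms] in auto)
  then show ?thesis
    by blast
qed

text \<open>The characteristic divides the order of the field, hence equals the prime below
  \<open>q\<close>. This makes the \<open>q\<close>-power maps additive later on.\<close>

lemma primepow_eq_CHAR_power:
  assumes "primepow q" "card (UNIV :: 'a::{field,finite} set) = q ^ n"
  shows "Factorial_Ring.prime CHAR('a)" "\<exists>e. q = CHAR('a) ^ e"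
proof -
  show CHAR: "Factorial_Ring.prime CHAR('a)"
    by (intro prime_CHAR_semidom finite_imp_CHAR_pos) simp
  obtain p k where p: "Factorial_Ring.prime p" "q = p ^ k"
    using assms(1) by (auto simp: primepow_def)
  have "CHAR('a) dvd p ^ (k * n)"
    using CHAR_dvd_CARD[where ?'a = 'a] assms(2) p(2) by (simp add: power_mult)
  then have "CHAR('a) = p"
    using CHAR p(1) prime_dvd_power primes_dvd_imp_eq by blast
  then show "\<exists>e. q = CHAR('a) ^ e"
    using p(2) by blast
qed

section \<open>Linear algebra over a finite subfield\<close>

definition lincomb :: "nat \<Rightarrow> (nat \<Rightarrow> 'a::field) \<Rightarrow> (nat \<Rightarrow> 'a) \<Rightarrow> 'a" where
  "lincomb m b c = (\<Sum>j<m. c j * b j)"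

text \<open>Coefficient families are extensional, so that there are exactly
  \<open>card K ^ m\<close> of them and spans can be counted.\<close>

definition span_over :: "'a::field set \<Rightarrow> nat \<Rightarrow> (nat \<Rightarrow> 'a) \<Rightarrow> 'a set" where
  "span_over K m b = lincomb m b ` ({..<m} \<rightarrow>\<^sub>E K)"

lemma in_span_over_iff:
  "x \<in> span_over K m b \<longleftrightarrow> (\<exists>c. (\<forall>j<m. c j \<in> K) \<and> x = (\<Sum>j<m. c j * b j))"
proof
  assume "\<exists>c. (\<forall>j<m. c j \<in> K) \<and> x = (\<Sum>j<m. c j * b j)"
  then obtain c where c: "\<forall>j<m. c j \<in> K" "x = (\<Sum>j<m. c j * b j)"
    by blast
  then have "x = lincomb m b (restrict c {..<m})" "restrict c {..<m} \<in> {..<m} \<rightarrow>\<^sub>E K"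
    by (auto simp: lincomb_def)
  then show "x \<in> span_over K m b"
    unfolding span_over_def by blast
qed (auto simp: span_over_def lincomb_def PiE_iff)

lemma spans_over_iff: "spans_over K m b \<longleftrightarrow> span_over K m b = UNIV"
  by (auto simp: spans_over_def set_eq_iff in_span_over_iff)

lemma lin_indep_overD:
  assumes "lin_indep_over K m b" "\<And>j. j < m \<Longrightarrow> c j \<in> K" "(\<Sum>j<m. c j * b j) = 0" "j < m"
  shows "c j = 0"
  using assms unfolding lin_indep_over_def by blast

lemma lin_indep_over_iff_inj_on:
  assumes "is_subfield K"
  shows "lin_indep_over K m b \<longleftrightarrow> inj_on (lincomb m b) ({..<m} \<rightarrow>\<^sub>E K)"
proof
  assume *: "lin_indep_over K m b"
  show "inj_on (lincomb m b) ({..<m} \<rightarrow>\<^sub>E K)"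
  proof (rule inj_onI)
    fix c d assume c: "c \<in> {..<m} \<rightarrow>\<^sub>E K" and d: "d \<in> {..<m} \<rightarrow>\<^sub>E K"
      and eq: "lincomb m b c = lincomb m b d"
    have "c j - d j \<in> K" if "j < m" for j
      using assms c d that unfolding is_subfield_def PiE_iff diff_conv_add_uminus by blast
    moreover have "(\<Sum>j<m. (c j - d j) * b j) = 0"
      using eq by (simp add: lincomb_def left_diff_distrib sum_subtractf)
    ultimately have "c j - d j = 0" if "j < m" for j
      using lin_indep_overD[OF *, of "\<lambda>j. c j - d j"] that by blast
    with c d show "c = d"
      by (intro PiE_ext) auto
  qed
next
  assume *: "inj_on (lincomb m b) ({..<m} \<rightarrow>\<^sub>E K)"
  show "lin_indep_over K m b"
    unfolding lin_indep_over_def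
  proof (intro allI impI)
    fix c j assume c: "\<forall>j<m. c j \<in> K" "(\<Sum>j<m. c j * b j) = 0" and "j < m"
    have "restrict c {..<m} = restrict (\<lambda>_. 0) {..<m}"
      by (rule inj_onD[OF *]) (use c assms in \<open>auto simp: lincomb_def is_subfield_def\<close>)
    from fun_cong[OF this, of j] show "c j = 0"
      using \<open>j < m\<close> by simp
  qed
qed

lemma card_span_over:
  assumes "is_subfield K" "lin_indep_over K m b"
  shows "card (span_over K m b) = card K ^ m"
  using assms by (simp add: span_over_def card_image lin_indep_over_iff_inj_on card_PiE)

text \<open>\<open>lincomb m b\<close> maps a set of \<open>card K ^ m\<close> families into a field
  of the same size, so it is injective exactly when it is surjective.\<close>

lemma
  fixes K :: "'a::{field,finite} set"
  assumes K: "is_subfield K" and card: "card (UNIV :: 'a set) = card K ^ m"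
  shows basis_iff_lin_indep: "is_basis_over K m b \<longleftrightarrow> lin_indep_over K m b"
    and basis_iff_spans: "is_basis_over K m b \<longleftrightarrow> spans_over K m b"
proof -
  have "spans_over K m b" if "lin_indep_over K m b"
    unfolding spans_over_iff
    by (rule card_eq_UNIV_imp_eq_UNIV) (use card_span_over[OF K that] card in auto)
  moreover have "lin_indep_over K m b" if "spans_over K m b"
    unfolding lin_indep_over_iff_inj_on[OF K]
    by (rule eq_card_imp_inj_on)
      (use that card in \<open>auto simp: spans_over_iff span_over_def card_PiE intro: finite_PiE\<close>)
  ultimately show "is_basis_over K m b \<longleftrightarrow> lin_indep_over K m b"
    "is_basis_over K m b \<longleftrightarrow> spans_over K m b"
    unfolding is_basis_over_def by blast+
qed

lemma lin_indep_over_Suc: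
  assumes "is_subfield K"
  shows "lin_indep_over K (Suc m) b \<longleftrightarrow> lin_indep_over K m b \<and> b m \<notin> span_over K m b"
proof (intro iffI conjI)
  assume *: "lin_indep_over K (Suc m) b"
  note K = assms[unfolded is_subfield_def]
  show "lin_indep_over K m b"
    unfolding lin_indep_over_def
  proof (intro allI impI)
    fix c j assume c: "\<forall>j<m. c j \<in> K" "(\<Sum>j<m. c j * b j) = 0" and "j < m"
    \<comment> \<open>The value \<open>c m\<close> is arbitrary and need not lie in
      \<open>K\<close>; resetting it to 0 extends the relation to length
      \<open>Suc m\<close>.\<close>
    have "(\<Sum>j<Suc m. (c(m := 0)) j * b j) = (\<Sum>j<m. c j * b j)"
      by simp
    then have "(c(m := 0)) j = 0"
      by (intro lin_indep_overD[OF *, where c = "c(m := 0)"]) (use c K \<open>j < m\<close> in auto)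
    with \<open>j < m\<close> show "c j = 0"
      by simp
  qed
  show "b m \<notin> span_over K m b"
  proof
    assume "b m \<in> span_over K m b"
    then obtain c where c: "\<forall>j<m. c j \<in> K" "b m = (\<Sum>j<m. c j * b j)"
      by (auto simp: in_span_over_iff)
    \<comment> \<open>Coefficient -1 at \<open>m\<close> turns membership in the span into a
      nontrivial relation.\<close>
    have "(c(m := - 1)) m = 0"
      by (rule lin_indep_overD[OF *, where c = "c(m := - 1)"]) (use c K in auto)
    then show False
      by simp
  qed
next
  assume *: "lin_indep_over K m b \<and> b m \<notin> span_over K m b"
  note K = assms[unfolded is_subfield_def]
  show "lin_indep_over K (Suc m) b"
    unfolding lin_indep_over_def
  proof (rule allI, rule impI, rule impI)
    fix c assume c: "\<forall>j<Suc m. c j \<in> K" "(\<Sum>j<Suc m. c j * b j) = 0"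
    have "c m = 0"
    proof (rule ccontr)
      assume "c m \<noteq> 0"
      have "c m * b m = - (\<Sum>j<m. c j * b j)"
        using c(2) by (simp add: eq_neg_iff_add_eq_0 add.commute)
      then have "b m = - inverse (c m) * (\<Sum>j<m. c j * b j)"
        using \<open>c m \<noteq> 0\<close> by (simp add: field_simps)
      then have "b m = (\<Sum>j<m. (- inverse (c m) * c j) * b j)"
        by (simp only: sum_distrib_left mult.assoc)
      moreover have "\<forall>j<m. - inverse (c m) * c j \<in> K"
        using c(1) K by (meson lessI less_SucI)
      ultimately have "b m \<in> span_over K m b"
        unfolding in_span_over_iff by (intro exI[of _ "\<lambda>j. - inverse (c m) * c j"]) simp
      with * show False
        by blast
    qed
    then have "\<forall>j<m. c j = 0"
      using * c unfolding lin_indep_over_def by simp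
    with \<open>c m = 0\<close> show "\<forall>j<Suc m. c j = 0"
      by (simp add: less_Suc_eq)
  qed
qed

lemma lin_indep_over_cong:
  "(\<And>j. j < m \<Longrightarrow> b j = b' j) \<Longrightarrow> lin_indep_over K m b \<longleftrightarrow> lin_indep_over K m b'"
  by (simp add: lin_indep_over_def)

lemma span_over_cong:
  "(\<And>j. j < m \<Longrightarrow> b j = b' j) \<Longrightarrow> span_over K m b = span_over K m b'"
  by (simp add: span_over_def lincomb_def)

text \<open>Vectors are chosen one at a time: \<open>m\<close> independent ones span
  \<open>card K ^ m\<close> elements, and the next may be anything outside that span.\<close>

lemma card_lin_indep_families:
  fixes K :: "'a::{field,finite} set"
  assumes K: "is_subfield K"
  shows "card {b \<in> {..<m} \<rightarrow>\<^sub>E UNIV. lin_indep_over K m b} =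
    (\<Prod>i<m. card (UNIV :: 'a set) - card K ^ i)"
proof (induction m)
  case 0
  then show ?case
    by (simp add: lin_indep_over_def)
next
  case (Suc m)
  let ?I = "\<lambda>m. {b \<in> {..<m} \<rightarrow>\<^sub>E (UNIV :: 'a set). lin_indep_over K m b}"
  have "bij_betw (\<lambda>(b, v). b(m := v)) (SIGMA b:?I m. UNIV - span_over K m b) (?I (Suc m))"
  \<comment> \<open>The inverse resets position \<open>m\<close> to \<open>undefined\<close>, the
    value that extensional families on \<open>{..<m}\<close> take there.\<close>
  proof (rule bij_betw_byWitness[where f' = "\<lambda>b. (b(m := undefined), b m)"])
    show "\<forall>a\<in>SIGMA b:?I m. UNIV - span_over K m b.
        (\<lambda>b. (b(m := undefined), b m)) ((\<lambda>(b, v). b(m := v)) a) = a"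
      by (auto simp: PiE_iff extensional_def)
    show "\<forall>b\<in>?I (Suc m). (\<lambda>(b, v). b(m := v)) ((\<lambda>b. (b(m := undefined), b m)) b) = b"
      by auto
    show "(\<lambda>(b, v). b(m := v)) ` (SIGMA b:?I m. UNIV - span_over K m b) \<subseteq> ?I (Suc m)"
    proof (rule image_subsetI)
      fix a assume "a \<in> (SIGMA b:?I m. UNIV - span_over K m b)"
      then obtain b v where a: "a = (b, v)"
        and b: "b \<in> {..<m} \<rightarrow>\<^sub>E UNIV" "lin_indep_over K m b" "v \<notin> span_over K m b"
        by blast
      have "lin_indep_over K m (b(m := v)) \<longleftrightarrow> lin_indep_over K m b"
        by (rule lin_indep_over_cong) simp
      moreover have "span_over K m (b(m := v)) = span_over K m b"
        by (rule span_over_cong) simp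
      ultimately show "(\<lambda>(b, v). b(m := v)) a \<in> ?I (Suc m)"
        using b unfolding a by (auto simp: lin_indep_over_Suc[OF K] PiE_iff extensional_def)
    qed
    show "(\<lambda>b. (b(m := undefined), b m)) ` ?I (Suc m) \<subseteq> (SIGMA b:?I m. UNIV - span_over K m b)"
    proof (rule image_subsetI)
      fix b assume "b \<in> ?I (Suc m)"
      then have b: "b \<in> {..<Suc m} \<rightarrow>\<^sub>E UNIV" "lin_indep_over K (Suc m) b"
        by auto
      have "lin_indep_over K m (b(m := undefined)) \<longleftrightarrow> lin_indep_over K m b"
        by (rule lin_indep_over_cong) simp
      moreover have "span_over K m (b(m := undefined)) = span_over K m b"
        by (rule span_over_cong) simp
      ultimately show "(b(m := undefined), b m) \<in> (SIGMA b:?I m. UNIV - span_over K m b)"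
        using b by (auto simp: lin_indep_over_Suc[OF K] PiE_iff extensional_def)
    qed
  qed
  then have "card (?I (Suc m)) = card (SIGMA b:?I m. UNIV - span_over K m b)"
    by (simp add: bij_betw_same_card)
  also have "\<dots> = (\<Sum>b\<in>?I m. card (UNIV - span_over K m b))"
    by (rule card_SigmaI) (auto intro: finite_subset[OF Collect_restrict finite_PiE])
  also have "\<dots> = (\<Sum>b\<in>?I m. card (UNIV :: 'a set) - card K ^ m)"
    by (rule sum.cong) (auto simp: card_Diff_subset card_span_over[OF K])
  also have "\<dots> = (\<Prod>i<Suc m. card (UNIV :: 'a set) - card K ^ i)"
    by (simp add: Suc.IH)
  finally show ?case .
qed

text \<open>The \<open>b j\<close> are the coefficients of a polynomial of degree below
  \<open>m\<close> that vanishes at \<open>m\<close> distinct points.\<close>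

lemma vandermonde_kernel_trivial:
  fixes x b :: "nat \<Rightarrow> 'a::field"
  assumes inj: "inj_on x {..<m}" and zero: "\<And>i. i < m \<Longrightarrow> (\<Sum>j<m. b j * x i ^ j) = 0"
    and "j < m"
  shows "b j = 0"
proof -
  define p where "p = (\<Sum>j<m. Polynomial.monom (b j) j)"
  have "Polynomial.degree p < m"
    unfolding p_def
    by (rule degree_sum_less) (use \<open>j < m\<close> in \<open>auto intro: le_less_trans[OF degree_monom_le]\<close>)
  have "p = 0"
    by (rule poly_eqI_degree[of "x ` {..<m}"])
      (use zero \<open>Polynomial.degree p < m\<close> \<open>j < m\<close> inj
        in \<open>auto simp: p_def poly_sum poly_monom card_image\<close>)
  then have "Polynomial.coeff p j = 0"
    by simp
  then show ?thesis
    using \<open>j < m\<close> by (simp add: p_def coeff_sum if_distrib cong: if_cong)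
qed

section \<open>Polynomials with exponents in an arithmetic progression\<close>

text \<open>For \<open>q \<ge> 2\<close> and \<open>t \<ge> 1\<close> the exponents are pairwise
  distinct, so no two monomials merge.\<close>

lemma coeff_gap_poly:
  assumes "q \<ge> 2" "t \<ge> 1" "i < m"
  shows "Polynomial.coeff (gap_poly q t m s a) (q ^ (i * t + s)) = a i"
proof -
  have "q ^ (k * t + s) = q ^ (i * t + s) \<longleftrightarrow> k = i" for k
    using assms by (simp add: power_inject_exp)
  then show ?thesis
    using assms(3) by (simp add: gap_poly_def coeff_sum if_distrib cong: if_cong)
qed

lemma gap_poly_cong:
  "(\<And>i. i < m \<Longrightarrow> a i = a' i) \<Longrightarrow> gap_poly q t m s a = gap_poly q t m s a'"
  by (simp add: gap_poly_def)

lemma poly_gap_poly: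
  "poly (gap_poly q t m s a) y = (\<Sum>i<m. a i * y ^ (q ^ (i * t + s)))"
  by (simp add: gap_poly_def poly_sum poly_monom)

lemma coeff_gap_poly_nonzeroE:
  assumes "Polynomial.coeff (gap_poly q t m s a) k \<noteq> 0"
  obtains i where "k = q ^ (i * t + s)"
proof -
  have "(\<Sum>i<m. Polynomial.coeff (Polynomial.monom (a i) (q ^ (i * t + s))) k) \<noteq> 0"
    using assms by (simp add: gap_poly_def coeff_sum)
  then obtain i where "Polynomial.coeff (Polynomial.monom (a i) (q ^ (i * t + s))) k \<noteq> 0"
    by (meson sum.not_neutral_contains_not_neutral)
  then show ?thesis
    using that by (auto split: if_splits)
qed

lemma linearized_gap_poly: "linearized K (gap_poly (card K) t m s a)"
  unfolding linearized_def by (blast elim: coeff_gap_poly_nonzeroE)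

section \<open>Conjugates and the relative trace\<close>

text \<open>The whole type is the big field and \<open>m\<close> its degree over \<open>L\<close>;
  the subfield of order \<open>q\<close> enters only with scatteredness.\<close>

locale finite_extension =
  fixes L :: "'a::{field,finite} set" and q t m :: nat
  assumes q: "primepow q" and t: "t \<ge> 1"
    and L: "is_subfield L" and card_L: "card L = q ^ t"
    and card_UNIV: "card (UNIV :: 'a set) = q ^ (t * m)"
begin

lemma q_ge_2: "q \<ge> 2"
  using primepow_gt_Suc_0[OF q] by simp

lemma card_UNIV_eq: "card (UNIV :: 'a set) = card L ^ m"
  by (simp add: card_UNIV card_L power_mult)

lemma m_pos: "m > 0"
proof (rule ccontr)
  assume "\<not> m > 0"
  then have "card (UNIV :: 'a set) = 1"
    using card_UNIV by simp
  moreover have "card {0, 1::'a} \<le> card (UNIV :: 'a set)"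
    by (intro card_mono) auto
  ultimately show False
    by simp
qed

lemma frobenius_add: "(x + y :: 'a) ^ (q ^ k) = x ^ (q ^ k) + y ^ (q ^ k)"
proof -
  obtain e where "q = CHAR('a) ^ e"
    using primepow_eq_CHAR_power(2)[OF q card_UNIV] by blast
  then show ?thesis
    by (intro freshmans_dream'[where n = "e * k"] primepow_eq_CHAR_power(1)[OF q card_UNIV])
      (simp add: power_mult)
qed

lemma frobenius_sum: "(\<Sum>i\<in>A. f i :: 'a) ^ (q ^ k) = (\<Sum>i\<in>A. f i ^ (q ^ k))"
proof -
  obtain e where "q = CHAR('a) ^ e"
    using primepow_eq_CHAR_power(2)[OF q card_UNIV] by blast
  then show ?thesis
    by (intro freshmans_dream_sum'[where n = "e * k"] primepow_eq_CHAR_power(1)[OF q card_UNIV])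
      (simp add: power_mult)
qed

lemma inj_frobenius: "inj (\<lambda>x::'a. x ^ (q ^ k))"
proof (rule injI)
  fix x y :: 'a assume "x ^ (q ^ k) = y ^ (q ^ k)"
  then have "(x - y) ^ (q ^ k) = 0"
    using frobenius_add[of "x - y" y k] by simp
  then show "x = y"
    by simp
qed

lemma power_card_UNIV: "(x::'a) ^ (q ^ (t * m)) = x"
  using subfield_power_card[of UNIV x] by (simp add: is_subfield_def card_UNIV)

lemma in_L_iff: "x \<in> L \<longleftrightarrow> x ^ (q ^ t) = x"
  by (simp add: subfield_iff_power_card[OF L] card_L)

lemma power_in_L:
  assumes "x \<in> L"
  shows "x ^ (q ^ (i * t)) = x"
proof (induction i)
  case (Suc i)
  have "x ^ (q ^ (Suc i * t)) = (x ^ (q ^ t)) ^ (q ^ (i * t))"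
    by (simp add: power_add power_mult)
  then show ?case
    using assms Suc by (simp add: in_L_iff)
qed simp

text \<open>If two conjugates agreed, the power map with exponent \<open>q ^ (d * t)\<close> for
  some \<open>0 < d < m\<close> would fix \<alpha>, hence all its powers, hence the whole field,
  which has too many elements for that.\<close>

lemma conjugates_distinct:
  fixes \<alpha> :: 'a
  assumes \<alpha>: "primitive_element \<alpha>"
  shows "inj_on (\<lambda>i. \<alpha> ^ (q ^ (i * t))) {..<m}"
proof (rule linorder_inj_onI')
  fix i j assume "i \<in> {..<m}" "j \<in> {..<m}" "i < j"
  show "\<alpha> ^ (q ^ (i * t)) \<noteq> \<alpha> ^ (q ^ (j * t))"
  proof
    define d where "d = j - i"
    have d: "d > 0" "d < m" "j = d + i"
      using \<open>i < j\<close> \<open>j \<in> {..<m}\<close> by (auto simp: d_def)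
    assume "\<alpha> ^ (q ^ (i * t)) = \<alpha> ^ (q ^ (j * t))"
    also have "\<dots> = (\<alpha> ^ (q ^ (d * t))) ^ (q ^ (i * t))"
      by (simp add: d(3) add_mult_distrib power_add power_mult)
    finally have fix_\<alpha>: "\<alpha> ^ (q ^ (d * t)) = \<alpha>"
      using inj_frobenius by (metis injD)
    have "x ^ (q ^ (d * t)) = x" for x :: 'a
    proof (cases "x = 0")
      case True
      then show ?thesis
        using q_ge_2 by (simp add: zero_power)
    next
      case False
      then obtain r :: nat where "x = \<alpha> ^ r"
        using \<alpha> unfolding primitive_element_def by blast
      then show ?thesis
        using fix_\<alpha> by (metis mult.commute power_mult)
    qed
    then have "card (UNIV :: 'a set) = card {x::'a. x ^ (q ^ (d * t)) = x}"
      by simp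
    \<comment> \<open>This inequality only supplies \<open>2 \<le> q ^ (d * t)\<close> for the root
      bound; the calculation resumes with the cardinality estimate below.\<close>
    also have "q ^ 1 \<le> q ^ (d * t)"
      using d t q_ge_2 by (intro power_increasing) auto
    then have "card {x::'a. x ^ (q ^ (d * t)) = x} \<le> q ^ (d * t)"
      using q_ge_2 by (intro card_power_eq_self_le) simp
    finally have "t * m \<le> d * t"
      using q_ge_2 by (simp add: card_UNIV power_increasing_iff)
    then show False
      using d t by (simp add: mult.commute)
  qed
qed

text \<open>Powers of the \<open>q ^ t\<close>-Frobenius fix \<open>L\<close>, so a relation over
  \<open>L\<close> among the powers of \<alpha> carries over to every conjugate of \<alpha>; the
  Vandermonde lemma then kills its coefficients.\<close>

lemma powers_basis:
  fixes \<alpha> :: 'a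
  assumes \<alpha>: "primitive_element \<alpha>"
  shows "is_basis_over L m (\<lambda>j. \<alpha> ^ j)"
  unfolding basis_iff_lin_indep[OF L card_UNIV_eq] lin_indep_over_def
proof (intro allI impI)
  fix c j assume c: "\<forall>j<m. c j \<in> L" "(\<Sum>j<m. c j * \<alpha> ^ j) = 0" and "j < m"
  have "(\<Sum>j<m. c j * (\<alpha> ^ (q ^ (i * t))) ^ j) = 0" for i
  proof -
    have "(\<Sum>j<m. c j * (\<alpha> ^ (q ^ (i * t))) ^ j) = (\<Sum>j<m. (c j * \<alpha> ^ j) ^ (q ^ (i * t)))"
      using c(1) by (intro sum.cong)
        (auto simp: power_mult_distrib power_in_L mult.commute simp flip: power_mult)
    also have "\<dots> = (\<Sum>j<m. c j * \<alpha> ^ j) ^ (q ^ (i * t))"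
      by (simp add: frobenius_sum)
    also have "\<dots> = 0"
      using c(2) q_ge_2 by (simp add: zero_power)
    finally show ?thesis .
  qed
  then show "c j = 0"
    using vandermonde_kernel_trivial[OF conjugates_distinct[OF \<alpha>]] \<open>j < m\<close> by blast
qed

definition rel_trace :: "'a \<Rightarrow> 'a" where
  "rel_trace x = (\<Sum>i<m. x ^ (q ^ (i * t)))"

lemma rel_trace_in_L: "rel_trace x \<in> L"
proof -
  have "rel_trace x ^ (q ^ t) = (\<Sum>i<m. x ^ (q ^ (Suc i * t)))"
    by (simp add: rel_trace_def frobenius_sum power_add mult.commute flip: power_mult)
  also have "\<dots> = (\<Sum>i<m. x ^ (q ^ (i * t)))"
    \<comment> \<open>Raising to \<open>q ^ t\<close> shifts the conjugates cyclically: the sum of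
      \<open>m + 1\<close> terms is peeled at either end, and the two end terms agree because
      \<open>x ^ (q ^ (t * m)) = x\<close>.\<close>
    using sum.lessThan_Suc[of "\<lambda>i. x ^ (q ^ (i * t))" m]
      sum.lessThan_Suc_shift[of "\<lambda>i. x ^ (q ^ (i * t))" m] power_card_UNIV[of x]
    by (simp add: mult.commute[of m t])
  finally show ?thesis
    by (simp add: in_L_iff rel_trace_def)
qed

lemma rel_trace_sum: "rel_trace (\<Sum>j\<in>A. f j) = (\<Sum>j\<in>A. rel_trace (f j))"
  unfolding rel_trace_def frobenius_sum by (rule sum.swap)

lemma rel_trace_smult: "c \<in> L \<Longrightarrow> rel_trace (c * x) = c * rel_trace x"
  by (simp add: rel_trace_def power_mult_distrib power_in_L sum_distrib_left)

lemma ex_rel_trace_nonzero: "\<exists>x. rel_trace x \<noteq> 0"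
proof (rule ccontr)
  assume *: "\<nexists>x. rel_trace x \<noteq> 0"
  \<comment> \<open>The trace is evaluation of the gap polynomial with \<open>s = 0\<close> and all
    coefficients 1.\<close>
  define p where "p = (gap_poly q t m 0 (\<lambda>_. 1) :: 'a poly)"
  have "Polynomial.coeff p (q ^ (0 * t + 0)) = 1"
    unfolding p_def by (rule coeff_gap_poly) (use q_ge_2 t m_pos in auto)
  then have "p \<noteq> 0"
    by auto
  \<comment> \<open>The trace polynomial has degree below the number of field elements.\<close>
  have "q ^ (i * t) < q ^ (t * m)" if "i < m" for i
    using that q_ge_2 t by (simp add: mult.commute[of t m])
  then have "Polynomial.degree p < q ^ (t * m)"
    unfolding p_def gap_poly_def
    by (intro degree_sum_less) (use q_ge_2 in \<open>auto simp: degree_monom_eq\<close>)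
  moreover have "{x. poly p x = 0} = UNIV"
    using * by (simp add: p_def poly_gap_poly rel_trace_def)
  ultimately show False
    using card_poly_roots_bound[OF \<open>p \<noteq> 0\<close>] by (simp add: card_UNIV)
qed

text \<open>Nondegeneracy of the trace pairing: for \<open>y \<noteq> 0\<close> the elements
  \<open>\<alpha> ^ j * y\<close> still span over \<open>L\<close>, so by linearity the trace would
  vanish everywhere.\<close>

lemma rel_trace_powers_zero_imp_zero:
  assumes \<alpha>: "primitive_element \<alpha>" and zero: "\<And>j. j < m \<Longrightarrow> rel_trace (\<alpha> ^ j * y) = 0"
  shows "y = 0"
proof (rule ccontr)
  assume "y \<noteq> 0"
  have "rel_trace x = 0" for x
  proof -
    obtain c where c: "\<forall>j<m. c j \<in> L" "x / y = (\<Sum>j<m. c j * \<alpha> ^ j)"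
      using powers_basis[OF \<alpha>] unfolding is_basis_over_def spans_over_def by blast
    have "x = (\<Sum>j<m. c j * (\<alpha> ^ j * y))"
      using c(2) \<open>y \<noteq> 0\<close> by (simp add: field_simps sum_distrib_left)
    then show ?thesis
      using c(1) zero by (simp add: rel_trace_sum rel_trace_smult)
  qed
  then show False
    using ex_rel_trace_nonzero by blast
qed

section \<open>The Vandermonde parametrization of the coefficients; roots and bases\<close>

definition conj_coeffs :: "'a \<Rightarrow> (nat \<Rightarrow> 'a) \<Rightarrow> nat \<Rightarrow> 'a" where
  "conj_coeffs \<alpha> b i = (\<Sum>j<m. b j * (\<alpha> ^ (q ^ (i * t))) ^ j)"

lemma basis_poly_eq: "basis_poly q t m s \<alpha> b = gap_poly q t m s (conj_coeffs \<alpha> b)"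
  by (simp add: basis_poly_def conj_coeffs_def[abs_def] mult.commute flip: power_mult)

lemma conj_coeffs_inj:
  assumes \<alpha>: "primitive_element \<alpha>"
    and eq: "\<And>i. i < m \<Longrightarrow> conj_coeffs \<alpha> b i = conj_coeffs \<alpha> b' i" and "j < m"
  shows "b j = b' j"
proof -
  have "(\<Sum>j<m. (b j - b' j) * (\<alpha> ^ (q ^ (i * t))) ^ j) = 0" if "i < m" for i
    using eq[OF that] by (simp add: conj_coeffs_def left_diff_distrib sum_subtractf)
  from vandermonde_kernel_trivial[OF conjugates_distinct[OF \<alpha>] this \<open>j < m\<close>]
  show ?thesis
    by simp
qed

text \<open>An injective self-map of the finite set of extensional families is onto, so the
  Vandermonde system is solvable for every right-hand side \<open>a\<close>.\<close>

lemma conj_coeffs_surj: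
  assumes \<alpha>: "primitive_element \<alpha>"
  obtains b where "b \<in> {..<m} \<rightarrow>\<^sub>E UNIV" "\<And>i. i < m \<Longrightarrow> conj_coeffs \<alpha> b i = a i"
proof -
  let ?E = "{..<m} \<rightarrow>\<^sub>E (UNIV :: 'a set)" and ?F = "\<lambda>b. restrict (conj_coeffs \<alpha> b) {..<m}"
  have "inj_on ?F ?E"
  proof (rule inj_onI)
    fix b b' assume b: "b \<in> ?E" "b' \<in> ?E" and "?F b = ?F b'"
    from fun_cong[OF this(3)] have "conj_coeffs \<alpha> b i = conj_coeffs \<alpha> b' i" if "i < m" for i
      using that by (simp add: restrict_def) (metis (full_types))
    then show "b = b'"
      using b conj_coeffs_inj[OF \<alpha>] by (intro PiE_ext) auto
  qed
  moreover have "?F ` ?E \<subseteq> ?E"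
    by (rule image_subsetI) simp
  moreover have "finite ?E"
    by (rule finite_PiE) simp_all
  ultimately have "?F ` ?E = ?E"
    by (intro endo_inj_surj)
  then have "restrict a {..<m} \<in> ?F ` ?E"
    by auto
  then obtain b where "b \<in> ?E" "restrict a {..<m} = ?F b"
    by blast
  moreover from fun_cong[OF this(2)] have "conj_coeffs \<alpha> b i = a i" if "i < m" for i
    using that by (simp add: restrict_def) (metis (full_types))
  ultimately show ?thesis
    using that by blast
qed

text \<open>Summing over the conjugates first produces traces, which lie in \<open>L\<close>: each
  value is thus an \<open>L\<close>-combination of the \<open>b j\<close>.\<close>

lemma poly_basis_poly:
  "poly (basis_poly q t m s \<alpha> b) y = (\<Sum>j<m. rel_trace (\<alpha> ^ j * y ^ (q ^ s)) * b j)"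
proof -
  have "poly (basis_poly q t m s \<alpha> b) y =
      (\<Sum>i<m. \<Sum>j<m. b j * (\<alpha> ^ j * y ^ (q ^ s)) ^ (q ^ (i * t)))"
    by (simp add: basis_poly_eq poly_gap_poly conj_coeffs_def sum_distrib_left power_mult_distrib
        power_add ac_simps flip: power_mult)
  also have "\<dots> = (\<Sum>j<m. \<Sum>i<m. b j * (\<alpha> ^ j * y ^ (q ^ s)) ^ (q ^ (i * t)))"
    by (rule sum.swap)
  finally show ?thesis
    by (simp add: rel_trace_def sum_distrib_left mult.commute)
qed

lemma basis_poly_no_root_iff:
  fixes \<alpha> :: 'a
  assumes \<alpha>: "primitive_element \<alpha>"
  shows "(\<forall>y. poly (basis_poly q t m s \<alpha> b) y = 0 \<longrightarrow> y = 0) \<longleftrightarrow> is_basis_over L m b"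
proof
  assume b: "is_basis_over L m b"
  show "\<forall>y. poly (basis_poly q t m s \<alpha> b) y = 0 \<longrightarrow> y = 0"
  proof (intro allI impI)
    fix y assume "poly (basis_poly q t m s \<alpha> b) y = 0"
    then have "(\<Sum>j<m. rel_trace (\<alpha> ^ j * y ^ (q ^ s)) * b j) = 0"
      by (simp add: poly_basis_poly)
    then have "rel_trace (\<alpha> ^ j * y ^ (q ^ s)) = 0" if "j < m" for j
      using that b rel_trace_in_L unfolding is_basis_over_def
      by (intro lin_indep_overD[where c = "\<lambda>j. rel_trace (\<alpha> ^ j * y ^ (q ^ s))"]) auto
    then have "y ^ (q ^ s) = 0"
      using rel_trace_powers_zero_imp_zero[OF \<alpha>] by blast
    then show "y = 0"
      by simp
  qed
next
  let ?f = "poly (basis_poly q t m s \<alpha> b)"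
  assume no_root: "\<forall>y. ?f y = 0 \<longrightarrow> y = 0"
  \<comment> \<open>Additivity turns the absence of nonzero roots into injectivity, hence
    surjectivity on a finite field.\<close>
  have add: "?f (x + y) = ?f x + ?f y" for x y
    by (simp add: basis_poly_eq poly_gap_poly frobenius_add distrib_left sum.distrib)
  have "inj ?f"
  proof (rule injI)
    fix x y assume "?f x = ?f y"
    then have "?f (x - y) = 0"
      using add[of "x - y" y] by simp
    then show "x = y"
      using no_root by auto
  qed
  then have "surj ?f"
    by (simp add: finite_UNIV_inj_surj)
  have "spans_over L m b"
    unfolding spans_over_def
  proof
    fix x
    obtain y where "x = ?f y"
      using \<open>surj ?f\<close> by blast
    \<comment> \<open>The traces at a preimage of \<open>x\<close> serve as its
      coefficients.\<close>
    then show "\<exists>c. (\<forall>j<m. c j \<in> L) \<and> x = (\<Sum>j<m. c j * b j)"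
      by (intro exI[of _ "\<lambda>j. rel_trace (\<alpha> ^ j * y ^ (q ^ s))"])
        (simp add: poly_basis_poly rel_trace_in_L)
  qed
  then show "is_basis_over L m b"
    by (simp add: basis_iff_spans[OF L card_UNIV_eq])
qed

section \<open>Scatteredness and the count of the polynomials\<close>

lemma R_partially_scattered_gap_poly_iff:
  fixes K :: "'a set"
  assumes K: "is_subfield K" "card K = q" and t2: "t \<ge> 2" and coprime: "gcd s t = 1"
  shows "R_partially_scattered K L (gap_poly q t m s a) \<longleftrightarrow>
    (\<forall>y. poly (gap_poly q t m s a) y = 0 \<longrightarrow> y = 0)"
proof -
  let ?f = "poly (gap_poly q t m s a)"
  \<comment> \<open>The factor \<open>q ^ (i * t)\<close> of each exponent acts trivially on
    \<open>L\<close>, which leaves a factor common to all terms.\<close>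
  have homog: "?f (c * y) = c ^ (q ^ s) * ?f y" if "c \<in> L" for c y
  proof -
    have "c ^ (q ^ (i * t + s)) = c ^ (q ^ s)" for i
      using power_in_L[OF that, of i] by (simp add: power_add power_mult)
    then show ?thesis
      by (simp add: poly_gap_poly power_mult_distrib sum_distrib_left ac_simps)
  qed
  show ?thesis
  proof
    assume scattered: "R_partially_scattered K L (gap_poly q t m s a)"
    \<comment> \<open>Here \<open>t \<ge> 2\<close> provides some \<open>c\<close> in
      \<open>L\<close> outside \<open>K\<close>. A nonzero root \<open>y\<close> and its multiple
      \<open>c * y\<close> then share the quotient 0, against scatteredness.\<close>
    have "q ^ 1 < q ^ t"
      using q_ge_2 t2 by (intro power_strict_increasing) auto
    then have "\<not> L \<subseteq> K"
      using card_mono[of K L] card_L K(2) by auto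
    then obtain c where c: "c \<in> L" "c \<notin> K"
      by blast
    then have "c \<noteq> 0"
      using K(1) by (auto simp: is_subfield_def)
    show "\<forall>y. ?f y = 0 \<longrightarrow> y = 0"
    proof (intro allI impI, rule ccontr)
      fix y assume y: "?f y = 0" "y \<noteq> 0"
      then have "?f (c * y) / (c * y) = ?f y / y"
        by (simp add: homog[OF c(1)])
      then have "c * y / y \<in> K"
        using scattered y c \<open>c \<noteq> 0\<close> unfolding R_partially_scattered_def
        by (metis mult_eq_0_iff nonzero_mult_div_cancel_right)
      then show False
        using c y by simp
    qed
  next
    assume no_root: "\<forall>y. ?f y = 0 \<longrightarrow> y = 0"
    have "y / z \<in> K" if "y \<noteq> 0" "z \<noteq> 0" and eq: "?f y / y = ?f z / z" and L: "y / z \<in> L" for y z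
    proof -
      define c where "c = y / z"
      have c: "y = c * z" "c \<noteq> 0" "c \<in> L"
        using that by (auto simp: c_def)
      have "c ^ (q ^ s) * ?f z = c * ?f z"
        using eq that c by (simp add: homog[OF c(3)] field_simps)
      moreover have "?f z \<noteq> 0"
        using no_root \<open>z \<noteq> 0\<close> by blast
      ultimately have fix_s: "c ^ (q ^ s) = c"
        by simp
      have iter_s: "c ^ (q ^ (s * k)) = c" for k
      proof (induction k)
        case (Suc k)
        have "c ^ (q ^ (s * Suc k)) = (c ^ (q ^ s)) ^ (q ^ (s * k))"
          by (simp add: power_add power_mult)
        then show ?case
          using Suc fix_s by simp
      qed simp
      \<comment> \<open>\<open>bezout_nat\<close> asks for a nonzero first argument; for
        \<open>s = 0\<close> the gcd would be \<open>t\<close>, which is at least 2.\<close>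
      have "s \<noteq> 0"
        using coprime t2 by (cases s) auto
      then obtain u v where uv: "s * u = t * v + 1"
        using bezout_nat[of s t] coprime by auto
      \<comment> \<open>By \<open>s * u = t * v + 1\<close>, the exponent splits into a part fixing
        every element of \<open>L\<close> and a single factor \<open>q\<close>, which leaves
        \<open>c ^ q = c\<close>.\<close>
      have "c = c ^ (q ^ (v * t + 1))"
        using iter_s[of u] by (simp add: uv mult.commute)
      also have "\<dots> = (c ^ (q ^ (v * t))) ^ q"
        by (simp add: mult.commute flip: power_mult)
      also have "\<dots> = c ^ q"
        by (simp add: power_in_L[OF c(3)])
      finally show ?thesis
        using subfield_iff_power_card[OF K(1)] K(2) by (simp add: c_def)
    qed
    then show "R_partially_scattered K L (gap_poly q t m s a)"
      using linearized_gap_poly[of K] K(2) unfolding R_partially_scattered_def by blast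
  qed
qed

text \<open>Restricting to extensional \<open>b\<close> prepares the count: each polynomial then
  comes from a single family, by \<open>inj_on_basis_poly\<close>.\<close>

lemma R_partially_scattered_set_eq:
  fixes \<alpha> :: 'a and K :: "'a set"
  assumes \<alpha>: "primitive_element \<alpha>"
    and K: "is_subfield K" "card K = q" and t2: "t \<ge> 2" and coprime: "gcd s t = 1"
  shows "{f \<in> range (gap_poly q t m s). R_partially_scattered K L f} =
    basis_poly q t m s \<alpha> ` {b \<in> {..<m} \<rightarrow>\<^sub>E UNIV. is_basis_over L m b}"
proof -
  have scattered: "R_partially_scattered K L (basis_poly q t m s \<alpha> b) \<longleftrightarrow> is_basis_over L m b" for b
    using R_partially_scattered_gap_poly_iff[OF K t2 coprime] basis_poly_no_root_iff[OF \<alpha>]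
    unfolding basis_poly_eq by blast
  have "\<exists>b \<in> {..<m} \<rightarrow>\<^sub>E UNIV. gap_poly q t m s a = basis_poly q t m s \<alpha> b" for a
    using conj_coeffs_surj[OF \<alpha>, of a] unfolding basis_poly_eq by (metis gap_poly_cong)
  then show ?thesis
    using scattered basis_poly_eq by fastforce
qed

text \<open>The polynomial determines its coefficients, and the Vandermonde lemma recovers
  \<open>b\<close> from them.\<close>

lemma inj_on_basis_poly:
  fixes \<alpha> :: 'a
  assumes \<alpha>: "primitive_element \<alpha>"
  shows "inj_on (basis_poly q t m s \<alpha>) ({..<m} \<rightarrow>\<^sub>E UNIV)"
proof (rule inj_onI)
  fix b b' assume b: "b \<in> {..<m} \<rightarrow>\<^sub>E (UNIV :: 'a set)" "b' \<in> {..<m} \<rightarrow>\<^sub>E (UNIV :: 'a set)"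
    and eq: "basis_poly q t m s \<alpha> b = basis_poly q t m s \<alpha> b'"
  have "conj_coeffs \<alpha> b i = conj_coeffs \<alpha> b' i" if "i < m" for i
    using eq coeff_gap_poly[OF q_ge_2 t that] unfolding basis_poly_eq by metis
  then show "b = b'"
    using b conj_coeffs_inj[OF \<alpha>] by (intro PiE_ext) auto
qed

text \<open>With the next lemma, this passes from the arbitrary functions \<open>b\<close> of the
  theorem to the extensional ones being counted.\<close>

lemma basis_poly_restrict:
  "basis_poly q t m s \<alpha> (restrict b {..<m}) = basis_poly q t m s \<alpha> b"
  by (simp add: basis_poly_def)

lemma is_basis_over_restrict: "is_basis_over L m (restrict b {..<m}) \<longleftrightarrow> is_basis_over L m b"
  by (simp add: is_basis_over_def lin_indep_over_def spans_over_def)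

end

theorem theorem5p5:
  fixes q n t t' s :: nat
    and Fq Fqt :: "'a::{field,finite} set"
  assumes "primepow q"
    and "n = t * t'" and "t \<ge> 2" and "t' \<ge> 1"
    and "gcd s t = 1"
    and "card (UNIV :: 'a set) = q ^ n"
    and "is_subfield Fq" and "card Fq = q"
    and "is_subfield Fqt" and "card Fqt = q ^ t"
  shows "(\<forall>\<alpha>. primitive_element \<alpha> \<longrightarrow>
            {f \<in> range (gap_poly q t t' s). R_partially_scattered Fq Fqt f} =
            {basis_poly q t t' s \<alpha> b | b. is_basis_over Fqt t' b}) \<and>
         {f \<in> range (gap_poly q t t' s). R_partially_scattered Fq Fqt f} =
           {basis_poly q t t' s \<alpha> b | \<alpha> b. primitive_element \<alpha> \<and> is_basis_over Fqt t' b} \<and>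
         card {f \<in> range (gap_poly q t t' s). R_partially_scattered Fq Fqt f} =
           (\<Prod>k<t'. q ^ n - q ^ (k * t))"
proof -
  interpret finite_extension Fqt q t t'
    by unfold_locales (use assms in auto)
  let ?S = "{f \<in> range (gap_poly q t t' s). R_partially_scattered Fq Fqt f}"
  note S_eq = R_partially_scattered_set_eq[OF _ \<open>is_subfield Fq\<close> \<open>card Fq = q\<close> \<open>t \<ge> 2\<close> \<open>gcd s t = 1\<close>]
  have char: "?S = {basis_poly q t t' s \<alpha> b | b. is_basis_over Fqt t' b}"
    if \<alpha>: "primitive_element \<alpha>" for \<alpha>
  proof -
    have "\<exists>b' \<in> {..<t'} \<rightarrow>\<^sub>E UNIV. is_basis_over Fqt t' b' \<and>
        basis_poly q t t' s \<alpha> b = basis_poly q t t' s \<alpha> b'" if "is_basis_over Fqt t' b" for b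
      using that by (intro bexI[of _ "restrict b {..<t'}"])
        (auto simp: basis_poly_restrict is_basis_over_restrict)
    then show ?thesis
      unfolding S_eq[OF \<alpha>] by blast
  qed
  obtain \<alpha> :: 'a where \<alpha>: "primitive_element \<alpha>"
    using ex_primitive_element by blast
  have "card ?S = card {b \<in> {..<t'} \<rightarrow>\<^sub>E UNIV. is_basis_over Fqt t' b}"
    unfolding S_eq[OF \<alpha>] by (intro card_image inj_on_subset[OF inj_on_basis_poly[OF \<alpha>]]) auto
  \<comment> \<open>Bases are the independent families of full length \<open>t'\<close>, counted
    with \<open>card Fqt = q ^ t\<close>.\<close>
  also have "\<dots> = (\<Prod>k<t'. q ^ n - q ^ (k * t))"
    unfolding basis_iff_lin_indep[OF L card_UNIV_eq] card_lin_indep_families[OF L]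
    using assms by (simp add: mult.commute flip: power_mult)
  finally have card: "card ?S = (\<Prod>k<t'. q ^ n - q ^ (k * t))" .
  \<comment> \<open>Every primitive \<alpha> yields the same set, so the union over all of them is
    that set once some \<alpha> exists.\<close>
  have "?S = {basis_poly q t t' s \<alpha> b | \<alpha> b. primitive_element \<alpha> \<and> is_basis_over Fqt t' b}"
    using char \<alpha> by blast
  with char card show ?thesis
    by blast
qed

end
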